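(* Let $k$ be a positive semidefinite covariance kernel, $x_1,\dots,x_N\in\mathbb{R}^d$, and $K$ the $N\times N$ real symmetric positive semidefinite matrix with entries $K_{ij}=k(x_i,x_j)$. Let $\sigma>0$, $\varepsilon\ge0$, and let $\Phi\in\mathbb{C}^{N\times M}$ with $M<N$ be such that $\tilde K=\Phi\Phi^*$ satisfies $\|\tilde K-K\|\le N\varepsilon$. Let $A_{\mathrm{FS}}=\Phi\Phi^*+\sigma^2I_N$ and $A_{\mathrm{WS}}=\Phi^*\Phi+\sigma^2I_M$, with condition numbers $\kappa_{\mathrm{FS}}=\kappa(A_{\mathrm{FS}})$ and $\kappa_{\mathrm{WS}}=\kappa(A_{\mathrm{WS}})$. Then both satisfy \[ \kappa_{\mathrm{FS}},\ \kappa_{\mathrm{WS}}\;\le\;\left(1+\frac{\varepsilon N}{\sigma^2}\right)\kappa(K+\sigma^2I)+\frac{\varepsilon N}{\sigma^2}. \]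
   Context: $\Phi^*$ denotes the conjugate transpose of $\Phi$; $\|\cdot\|$ is the spectral norm; $\kappa(A)=\|A\|\,\|A^{-1}\|$. *)

theory Defs
  imports "HOL-Analysis.Analysis"
begin

text \<open>Positive semidefinite (covariance) kernel: symmetric, and every Gram matrix
  on finitely many points is positive semidefinite.\<close>
definition psd_kernel :: "('a \<Rightarrow> 'a \<Rightarrow> real) \<Rightarrow> bool" where
  "psd_kernel k \<longleftrightarrow> (\<forall>x y. k x y = k y x) \<and>
     (\<forall>(n::nat) (xs::nat \<Rightarrow> 'a) (c::nat \<Rightarrow> real).
        0 \<le> (\<Sum>i<n. \<Sum>j<n. c i * c j * k (xs i) (xs j)))"

text \<open>Conjugate transpose of a complex matrix.\<close>
definition cnj_transpose :: "complex^'m^'n \<Rightarrow> complex^'n^'m" where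
  "cnj_transpose A = (\<chi> i j. cnj (A $ j $ i))"

text \<open>Spectral norm = operator norm induced by the Euclidean norm.\<close>
definition spec_norm :: "complex^'m^'n \<Rightarrow> real" where
  "spec_norm A = onorm (\<lambda>v. A *v v)"

text \<open>Condition number.\<close>
definition cond_num :: "complex^'n^'n \<Rightarrow> real" where
  "cond_num A = spec_norm A * spec_norm (matrix_inv A)"

end

theory Submission
  imports Defs
begin

(*
  A_FS = \<Phi>\<Phi>* + \<sigma>^2 I and A_WS = \<Phi>*\<Phi> + \<sigma>^2 I both dominate \<sigma>^2 I as Hermitian forms, so
  their inverses have norm at most 1/\<sigma>^2, and both have norm at most
  \<parallel>\<Phi>\<parallel>^2 + \<sigma>^2 \<le> \<parallel>K + \<sigma>^2 I\<parallel> + N\<epsilon>; hence both condition numbers are at most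
  (\<parallel>K + \<sigma>^2 I\<parallel> + N\<epsilon>)/\<sigma>^2. Because M < N, \<Phi>* has a nonzero kernel vector v, and on v the
  matrix K agrees with -(\<Phi>\<Phi>* - K), so \<parallel>(K + \<sigma>^2 I) v\<parallel> \<le> (N\<epsilon> + \<sigma>^2) \<parallel>v\<parallel>. Thus
  \<parallel>(K + \<sigma>^2 I)^-1\<parallel> \<ge> 1/(N\<epsilon> + \<sigma>^2), i.e. \<parallel>K + \<sigma>^2 I\<parallel> \<le> \<kappa>(K + \<sigma>^2 I) (N\<epsilon> + \<sigma>^2), which
  turns the first bound into the claimed one.
*)

definition cinner :: "complex^'n \<Rightarrow> complex^'n \<Rightarrow> complex" where
  "cinner u v = (\<Sum>i\<in>UNIV. cnj (u$i) * v$i)"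

lemma Re_cinner_self: "Re (cinner u u) = (norm u)\<^sup>2"
proof -
  have "Re (cinner u u) = (\<Sum>i\<in>UNIV. (cmod (u$i))\<^sup>2)"
    unfolding cinner_def by (simp add: cmod_power2) (simp add: power2_eq_square)
  also have "\<dots> = (norm u)\<^sup>2"
    unfolding norm_vec_def L2_set_def by (simp add: sum_nonneg)
  finally show ?thesis .
qed

lemma Re_cinner_le_norm_mult: "Re (cinner u v) \<le> norm u * norm v"
proof -
  have "Re (cinner u v) \<le> cmod (cinner u v)"
    by (rule complex_Re_le_cmod)
  also have "\<dots> \<le> (\<Sum>i\<in>UNIV. cmod (u$i) * cmod (v$i))"
    unfolding cinner_def by (rule order_trans[OF norm_sum]) (simp add: norm_mult)
  also have "\<dots> \<le> L2_set (\<lambda>i. cmod (u$i)) UNIV * L2_set (\<lambda>i. cmod (v$i)) UNIV"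
    using L2_set_mult_ineq[of "\<lambda>i. cmod (u$i)" "\<lambda>i. cmod (v$i)" UNIV] by simp
  finally show ?thesis by (simp add: norm_vec_def)
qed

lemma cinner_add_right: "cinner u (v + w) = cinner u v + cinner u w"
  unfolding cinner_def by (simp add: distrib_left sum.distrib)

lemma cinner_scaleR_right: "cinner u (r *\<^sub>R v) = of_real r * cinner u v"
  unfolding cinner_def vector_scaleR_component unfolding scaleR_conv_of_real
  by (simp add: sum_distrib_left mult.left_commute)

lemma cinner_zero_right [simp]: "cinner u 0 = 0"
  unfolding cinner_def by simp

lemma cinner_cnj_transpose: "cinner u (P *v v) = cinner (cnj_transpose P *v u) v"
proof -
  have "cinner u (P *v v) = (\<Sum>i\<in>UNIV. \<Sum>j\<in>UNIV. cnj (u$i) * P$i$j * v$j)"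
    unfolding cinner_def matrix_vector_mult_def by (simp add: sum_distrib_left mult.assoc)
  also have "\<dots> = (\<Sum>j\<in>UNIV. \<Sum>i\<in>UNIV. cnj (u$i) * P$i$j * v$j)"
    by (rule sum.swap)
  also have "\<dots> = cinner (cnj_transpose P *v u) v"
    unfolding cinner_def matrix_vector_mult_def cnj_transpose_def
    by (simp add: cnj_sum sum_distrib_left sum_distrib_right mult.commute mult.left_commute)
  finally show ?thesis .
qed

lemma cnj_transpose_cnj_transpose [simp]: "cnj_transpose (cnj_transpose A) = A"
  unfolding cnj_transpose_def by (simp add: vec_eq_iff)

lemma mat_of_real_mult_vector [simp]: "mat (complex_of_real r) *v v = r *\<^sub>R v"
proof -
  have delta: "(if i = j then c else 0) * z = (if i = j then c * z else 0)"
    for i j and c z :: complex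
    by simp
  show ?thesis
    unfolding vec_eq_iff matrix_vector_mult_def mat_def vector_scaleR_component
    unfolding scaleR_conv_of_real by (simp add: delta)
qed

lemma norm_matrix_vector_le_spec_norm: "norm (A *v v) \<le> spec_norm A * norm v"
  unfolding spec_norm_def by (rule onorm) simp

lemma spec_norm_nonneg: "0 \<le> spec_norm A"
  unfolding spec_norm_def by (rule onorm_pos_le) simp

lemma spec_norm_bound: "0 \<le> b \<Longrightarrow> (\<And>v. norm (A *v v) \<le> b * norm v) \<Longrightarrow> spec_norm A \<le> b"
  unfolding spec_norm_def by (rule onorm_bound)

lemma spec_norm_triangle: "spec_norm (A + B) \<le> spec_norm A + spec_norm B"
  unfolding spec_norm_def matrix_vector_mult_add_rdistrib
  by (rule onorm_triangle) simp_all

lemma spec_norm_mult_le: "spec_norm (A ** B) \<le> spec_norm A * spec_norm B"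
  unfolding spec_norm_def matrix_vector_mul_assoc[symmetric]
  using onorm_compose[of "(*v) A" "(*v) B"] by (simp add: o_def)

lemma spec_norm_add_mat_of_real_le:
  "spec_norm (A + mat (complex_of_real r)) \<le> spec_norm A + \<bar>r\<bar>"
proof (rule spec_norm_bound)
  fix v
  have "norm ((A + mat (complex_of_real r)) *v v) \<le> norm (A *v v) + \<bar>r\<bar> * norm v"
    using norm_triangle_ineq[of "A *v v" "r *\<^sub>R v"] by (simp add: matrix_vector_mult_add_rdistrib)
  then show "norm ((A + mat (complex_of_real r)) *v v) \<le> (spec_norm A + \<bar>r\<bar>) * norm v"
    using norm_matrix_vector_le_spec_norm[of A v] by (simp add: algebra_simps)
qed (simp add: add_nonneg_nonneg spec_norm_nonneg)

lemma spec_norm_cnj_transpose_le: "spec_norm (cnj_transpose P) \<le> spec_norm P"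
proof (rule spec_norm_bound[OF spec_norm_nonneg])
  fix v
  let ?w = "cnj_transpose P *v v"
  have "norm ?w * norm ?w = Re (cinner v (P *v ?w))"
    using cinner_cnj_transpose[of v P ?w] by (simp add: Re_cinner_self power2_eq_square)
  also have "\<dots> \<le> norm v * (spec_norm P * norm ?w)"
    by (rule order_trans[OF Re_cinner_le_norm_mult mult_left_mono])
       (simp_all add: norm_matrix_vector_le_spec_norm)
  finally show "norm ?w \<le> spec_norm P * norm v"
    by (cases "?w = 0") (simp_all add: spec_norm_nonneg mult_ac)
qed

lemma spec_norm_cnj_transpose [simp]: "spec_norm (cnj_transpose P) = spec_norm P"
  using spec_norm_cnj_transpose_le[of P] spec_norm_cnj_transpose_le[of "cnj_transpose P"]
  by simp

lemma Re_cinner_gram_shift: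
  "Re (cinner v ((\<Psi> ** cnj_transpose \<Psi> + mat (complex_of_real s)) *v v))
     = (norm (cnj_transpose \<Psi> *v v))\<^sup>2 + s * (norm v)\<^sup>2"
  using cinner_cnj_transpose[of v \<Psi> "cnj_transpose \<Psi> *v v"]
  by (simp add: matrix_vector_mult_add_rdistrib matrix_vector_mul_assoc[symmetric]
      cinner_add_right cinner_scaleR_right Re_cinner_self)

lemma spec_norm_gram_shift_ge:
  "(spec_norm \<Psi>)\<^sup>2 + s \<le> spec_norm (\<Psi> ** cnj_transpose \<Psi> + mat (complex_of_real s))"
proof -
  let ?A = "\<Psi> ** cnj_transpose \<Psi> + mat (complex_of_real s)"
  have gram_le: "(norm (cnj_transpose \<Psi> *v v))\<^sup>2 \<le> (spec_norm ?A - s) * (norm v)\<^sup>2" for v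
  proof -
    have "(norm (cnj_transpose \<Psi> *v v))\<^sup>2 + s * (norm v)\<^sup>2 \<le> norm v * norm (?A *v v)"
      using Re_cinner_le_norm_mult[of v "?A *v v"] by (simp add: Re_cinner_gram_shift)
    also have "\<dots> \<le> norm v * (spec_norm ?A * norm v)"
      by (simp add: mult_left_mono norm_matrix_vector_le_spec_norm)
    finally show ?thesis by (simp add: power2_eq_square algebra_simps)
  qed
  have gap_nonneg: "0 \<le> spec_norm ?A - s"
    using order_trans[OF zero_le_power2 gram_le[of "axis undefined 1"]] by simp
  moreover have "norm (cnj_transpose \<Psi> *v v) \<le> sqrt (spec_norm ?A - s) * norm v" for v
    using real_le_rsqrt[OF gram_le[of v]] by (simp add: real_sqrt_mult)
  ultimately have "spec_norm (cnj_transpose \<Psi>) \<le> sqrt (spec_norm ?A - s)"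
    by (metis spec_norm_bound real_sqrt_ge_zero)
  then have "(spec_norm \<Psi>)\<^sup>2 \<le> (sqrt (spec_norm ?A - s))\<^sup>2"
    by (simp add: power_mono spec_norm_nonneg)
  then show ?thesis
    using gap_nonneg by simp
qed

lemma spec_norm_gram_shift_swap_le:
  assumes "0 \<le> s"
  shows "spec_norm (cnj_transpose \<Psi> ** \<Psi> + mat (complex_of_real s))
           \<le> spec_norm (\<Psi> ** cnj_transpose \<Psi> + mat (complex_of_real s))"
proof -
  have "spec_norm (cnj_transpose \<Psi> ** \<Psi> + mat (complex_of_real s))
          \<le> spec_norm (cnj_transpose \<Psi> ** \<Psi>) + s"
    using spec_norm_add_mat_of_real_le[of "cnj_transpose \<Psi> ** \<Psi>" s] assms by simp
  also have "\<dots> \<le> spec_norm (cnj_transpose \<Psi>) * spec_norm \<Psi> + s"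
    using spec_norm_mult_le[of "cnj_transpose \<Psi>" \<Psi>] by simp
  also have "\<dots> \<le> spec_norm (\<Psi> ** cnj_transpose \<Psi> + mat (complex_of_real s))"
    using spec_norm_gram_shift_ge[of \<Psi> s] by (simp add: power2_eq_square)
  finally show ?thesis .
qed

lemma invertible_matrix_inv:
  assumes "invertible H"
  shows "matrix_inv H ** H = mat 1" "H ** matrix_inv H = mat 1"
  using someI_ex[OF assms[unfolded invertible_def]] unfolding matrix_inv_def by auto

lemma coercive_invertible:
  fixes H :: "complex^'n^'n"
  assumes "0 < c" and "\<And>v. c * (norm v)\<^sup>2 \<le> Re (cinner v (H *v v))"
  shows "invertible H"
proof -
  have "x = 0" if "H *v x = 0" for x
    using assms(2)[of x] that \<open>0 < c\<close> by (simp add: mult_le_0_iff)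
  then show ?thesis
    using matrix_left_invertible_ker invertible_left_inverse by blast
qed

lemma coercive_spec_norm_matrix_inv_le:
  fixes H :: "complex^'n^'n"
  assumes c: "0 < c" and coercive: "\<And>v. c * (norm v)\<^sup>2 \<le> Re (cinner v (H *v v))"
  shows "spec_norm (matrix_inv H) \<le> 1 / c"
proof (rule spec_norm_bound)
  fix w
  let ?v = "matrix_inv H *v w"
  have "H *v ?v = w"
    using invertible_matrix_inv(2)[OF coercive_invertible[OF assms]]
    by (simp add: matrix_vector_mul_assoc)
  then have "c * norm ?v * norm ?v \<le> norm w * norm ?v"
    using coercive[of ?v] Re_cinner_le_norm_mult[of ?v w]
    by (simp add: power2_eq_square mult_ac)
  then have "c * norm ?v \<le> norm w"
    by (cases "?v = 0") simp_all
  then show "norm ?v \<le> 1 / c * norm w"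
    using c by (simp add: field_simps)
qed (use c in simp)

lemma spec_norm_matrix_inv_gram_shift_le:
  assumes "0 < s"
  shows "spec_norm (matrix_inv (\<Psi> ** cnj_transpose \<Psi> + mat (complex_of_real s))) \<le> 1 / s"
  by (rule coercive_spec_norm_matrix_inv_le[OF assms]) (simp add: Re_cinner_gram_shift)

lemma spec_norm_le_cond_num_mult:
  fixes B :: "complex^'n^'n"
  assumes "invertible B" and "v \<noteq> 0" and "norm (B *v v) \<le> c * norm v"
  shows "spec_norm B \<le> cond_num B * c"
proof -
  have "norm v = norm (matrix_inv B *v (B *v v))"
    by (simp add: matrix_vector_mul_assoc invertible_matrix_inv(1)[OF assms(1)])
  also have "\<dots> \<le> spec_norm (matrix_inv B) * (c * norm v)"
    by (rule order_trans[OF norm_matrix_vector_le_spec_norm mult_left_mono])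
       (simp_all add: assms(3) spec_norm_nonneg)
  finally have "1 \<le> spec_norm (matrix_inv B) * c"
    using \<open>v \<noteq> 0\<close> by (simp add: mult_ac)
  from mult_left_mono[OF this spec_norm_nonneg[of B]] show ?thesis
    unfolding cond_num_def by (simp add: mult.assoc)
qed

lemma psd_kernel_gram_nonneg:
  fixes x :: "'n::finite \<Rightarrow> 'a" and c :: "'n \<Rightarrow> real"
  assumes "psd_kernel k"
  shows "0 \<le> (\<Sum>i\<in>UNIV. \<Sum>j\<in>UNIV. c i * c j * k (x i) (x j))"
proof -
  obtain h :: "nat \<Rightarrow> 'n" where h: "bij_betw h {..<CARD('n)} UNIV"
    using ex_bij_betw_nat_finite[of "UNIV :: 'n set"] by (auto simp: atLeast0LessThan)
  have "0 \<le> (\<Sum>i<CARD('n). \<Sum>j<CARD('n). c (h i) * c (h j) * k (x (h i)) (x (h j)))"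
    using assms unfolding psd_kernel_def by (metis (mono_tags) comp_apply)
  also have "\<dots> = (\<Sum>i\<in>UNIV. \<Sum>j\<in>UNIV. c i * c j * k (x i) (x j))"
    using sum.reindex_bij_betw[OF h, of "\<lambda>i. \<Sum>j\<in>UNIV. c i * c j * k (x i) (x j)"]
      sum.reindex_bij_betw[OF h, of "\<lambda>j. c _ * c j * k (x _) (x j)"]
    by simp
  finally show ?thesis .
qed

lemma psd_kernel_Re_cinner_nonneg:
  fixes x :: "'n::finite \<Rightarrow> 'a"
  assumes "psd_kernel k"
  shows "0 \<le> Re (cinner v ((\<chi> i j. complex_of_real (k (x i) (x j))) *v v))"
proof -
  have Re_term: "Re (cnj a * (complex_of_real r * b)) = Re a * Re b * r + Im a * Im b * r"
    for a b r
    by (simp add: algebra_simps)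
  have "Re (cinner v ((\<chi> i j. complex_of_real (k (x i) (x j))) *v v))
     = (\<Sum>i\<in>UNIV. \<Sum>j\<in>UNIV. Re (v$i) * Re (v$j) * k (x i) (x j))
     + (\<Sum>i\<in>UNIV. \<Sum>j\<in>UNIV. Im (v$i) * Im (v$j) * k (x i) (x j))"
    unfolding cinner_def matrix_vector_mult_def
    by (simp add: sum_distrib_left Re_term sum.distrib) (simp add: mult_ac)
  then show ?thesis
    using psd_kernel_gram_nonneg[OF assms, of "\<lambda>i. Re (v$i)" x]
      psd_kernel_gram_nonneg[OF assms, of "\<lambda>i. Im (v$i)" x]
    by simp
qed

lemma psd_kernel_gram_shift_coercive:
  fixes x :: "'n::finite \<Rightarrow> 'a"
  assumes "psd_kernel k"
  shows "s * (norm v)\<^sup>2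
           \<le> Re (cinner v (((\<chi> i j. complex_of_real (k (x i) (x j))) + mat (complex_of_real s)) *v v))"
  using psd_kernel_Re_cinner_nonneg[OF assms, of v x]
  by (simp add: matrix_vector_mult_add_rdistrib cinner_add_right cinner_scaleR_right Re_cinner_self)

lemma matrix_vector_mult_nontrivial_kernel:
  fixes P :: "'a::field^'n^'m"
  assumes "CARD('m) < CARD('n)"
  shows "\<exists>v. v \<noteq> 0 \<and> P *v v = 0"
proof (rule ccontr)
  assume "\<not> ?thesis"
  then have "inj ((*v) P)"
    unfolding vec.inj_iff_eq_0 by blast
  have "CARD('n) = vec.dim (UNIV :: ('a^'n) set)"
    by (simp only: vec_dim_card)
  also have "\<dots> = vec.dim (range ((*v) P))"
    using vec.dim_image_eq[OF matrix_vector_mul_linear_gen,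
        OF inj_on_subset[OF \<open>inj ((*v) P)\<close> subset_UNIV]]
    by (rule sym)
  also have "\<dots> \<le> vec.dim (UNIV :: ('a^'m) set)"
    by (rule vec.dim_subset) simp
  also have "\<dots> = CARD('m)"
    by (simp only: vec_dim_card)
  finally show False
    using assms by simp
qed

lemma norm_shift_on_kernel_of_approximant_le:
  assumes approx: "spec_norm (\<Psi> ** cnj_transpose \<Psi> - K) \<le> e"
    and kernel: "cnj_transpose \<Psi> *v v = 0" and "0 \<le> s"
  shows "norm ((K + mat (complex_of_real s)) *v v) \<le> (e + s) * norm v"
proof -
  have "(K + mat (complex_of_real s)) *v v = s *\<^sub>R v - (\<Psi> ** cnj_transpose \<Psi> - K) *v v"
    by (simp add: matrix_vector_mult_add_rdistrib matrix_vector_mult_diff_rdistrib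
        matrix_vector_mul_assoc[symmetric] kernel)
  then have "norm ((K + mat (complex_of_real s)) *v v)
               \<le> norm (s *\<^sub>R v) + norm ((\<Psi> ** cnj_transpose \<Psi> - K) *v v)"
    by (simp only: norm_triangle_ineq4)
  also have "\<dots> \<le> (e + s) * norm v"
    using \<open>0 \<le> s\<close> order_trans[OF norm_matrix_vector_le_spec_norm mult_right_mono[OF approx]]
    by (simp add: algebra_simps)
  finally show ?thesis .
qed

lemma cond_num_perturbation_le:
  assumes s: "0 < s" and e: "0 \<le> e"
    and norm_X: "spec_norm X \<le> spec_norm B + e"
    and norm_inv_X: "spec_norm (matrix_inv X) \<le> 1 / s"
    and norm_B: "spec_norm B \<le> cond_num B * (e + s)"
  shows "cond_num X \<le> (1 + e / s) * cond_num B + e / s"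
proof -
  have "cond_num X \<le> (spec_norm B + e) * (1 / s)"
    unfolding cond_num_def
    by (rule mult_mono[OF norm_X norm_inv_X]) (simp_all add: spec_norm_nonneg e add_nonneg_nonneg)
  also have "\<dots> \<le> (cond_num B * (e + s) + e) / s"
    using norm_B s by (simp add: divide_right_mono)
  also have "\<dots> = (1 + e / s) * cond_num B + e / s"
    using s by (simp add: field_simps)
  finally show ?thesis .
qed

theorem lemma5p4:
  fixes k :: "real^'d \<Rightarrow> real^'d \<Rightarrow> real"
    and x :: "'n::finite \<Rightarrow> real^'d"
    and \<Phi> :: "complex^'m::finite^'n"
    and \<sigma> \<epsilon> :: real
  assumes kern: "psd_kernel k"
    and sig: "\<sigma> > 0"
    and eps: "\<epsilon> \<ge> 0"
    and MN: "CARD('m) < CARD('n)"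
    and approx: "spec_norm (\<Phi> ** cnj_transpose \<Phi> -
                   (\<chi> i j. complex_of_real (k (x i) (x j)))) \<le> real CARD('n) * \<epsilon>"
  shows "cond_num (\<Phi> ** cnj_transpose \<Phi> + mat (complex_of_real (\<sigma>\<^sup>2)))
           \<le> (1 + \<epsilon> * real CARD('n) / \<sigma>\<^sup>2) *
              cond_num ((\<chi> i j. complex_of_real (k (x i) (x j))) + mat (complex_of_real (\<sigma>\<^sup>2)))
             + \<epsilon> * real CARD('n) / \<sigma>\<^sup>2
       \<and> cond_num (cnj_transpose \<Phi> ** \<Phi> + mat (complex_of_real (\<sigma>\<^sup>2)))
           \<le> (1 + \<epsilon> * real CARD('n) / \<sigma>\<^sup>2) *
              cond_num ((\<chi> i j. complex_of_real (k (x i) (x j))) + mat (complex_of_real (\<sigma>\<^sup>2)))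
             + \<epsilon> * real CARD('n) / \<sigma>\<^sup>2"
proof -
  define K :: "complex^'n^'n" where "K = (\<chi> i j. complex_of_real (k (x i) (x j)))"
  define s e where "s = \<sigma>\<^sup>2" and "e = \<epsilon> * real CARD('n)"
  define B where "B = K + mat (complex_of_real s)"
  have s: "0 < s" and e: "0 \<le> e" and approx_K: "spec_norm (\<Phi> ** cnj_transpose \<Phi> - K) \<le> e"
    using sig eps approx by (simp_all add: s_def e_def K_def mult.commute)
  have B_invertible: "invertible B"
    using coercive_invertible[OF s psd_kernel_gram_shift_coercive[OF kern]]
    unfolding B_def K_def .
  obtain v0 where v0: "v0 \<noteq> 0" "cnj_transpose \<Phi> *v v0 = 0"
    using matrix_vector_mult_nontrivial_kernel[OF MN] by blast
  have "norm (B *v v0) \<le> (e + s) * norm v0"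
    unfolding B_def using norm_shift_on_kernel_of_approximant_le[OF approx_K v0(2)] s by simp
  then have norm_B: "spec_norm B \<le> cond_num B * (e + s)"
    by (rule spec_norm_le_cond_num_mult[OF B_invertible v0(1)])
  have norm_FS: "spec_norm (\<Phi> ** cnj_transpose \<Phi> + mat (complex_of_real s)) \<le> spec_norm B + e"
    using spec_norm_triangle[of B "\<Phi> ** cnj_transpose \<Phi> - K"] approx_K
    by (simp add: B_def algebra_simps)
  have norm_WS: "spec_norm (cnj_transpose \<Phi> ** \<Phi> + mat (complex_of_real s)) \<le> spec_norm B + e"
    using spec_norm_gram_shift_swap_le[of s \<Phi>] norm_FS s by linarith
  have inv_WS: "spec_norm (matrix_inv (cnj_transpose \<Phi> ** \<Phi> + mat (complex_of_real s))) \<le> 1 / s"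
    using spec_norm_matrix_inv_gram_shift_le[OF s, of "cnj_transpose \<Phi>"] by simp
  from cond_num_perturbation_le[OF s e norm_FS spec_norm_matrix_inv_gram_shift_le[OF s] norm_B]
    cond_num_perturbation_le[OF s e norm_WS inv_WS norm_B]
  show ?thesis
    unfolding s_def e_def B_def K_def by (rule conjI)
qed

end
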